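(* If an incidence theorem with some matrix has a simplicial-complex proof over an infinite field, then it is true over the field.
   Context: Setting. Over a field $\mathbb{F}$, an incidence theorem with an $m\times n$ matrix $M$ (entries $\pm1,0$) asserts that $P_1\in L_1$ for all points $P_1,\dots,P_m$ and lines $L_1,\dots,L_n$ of the projective plane such that $M_{ij}=1\Rightarrow P_i\in L_j$ and $M_{ij}=-1\Rightarrow P_i\notin L_j$. Excision. In a finite 2-dimensional simplicial complex, an open face $a_0b_0c_0$ can be excised over $\mathbb{F}^*$ if the following holds for every function $U$ from oriented edges to $\mathbb{F}^*$. Suppose $U(ab)=U(ba)^{-1}$ for all edges, and $U(ab)U(bc)U(ca)=1$ for every face $abc\ne a_0b_0c_0$. Then also $U(a_0b_0)U(b_0c_0)U(c_0a_0)=1$. An elementary simplicial-complex proof over $\mathbb{F}$ is a finite 2-dimensional simplicial complex with vertex/edge/face sets $V,E,F$ and maps $p\colon V\sqcup E\to\{1,\dots,m\}$, $l\colon F\sqcup E\to\{1,\dots,n\}$ satisfying four conditions: (0) there is a unique pair (edge $i$, face $j$) with $i\subset j$ and $p(i)=l(j)=1$; ( * ) in this pair, the open face $j$ can be excised over $\mathbb{F}^*$; (+1) for every other pair with $i\subset j$, where either $i$ is an edge and $j$ a face, or $i\in V\sqcup E$ and $j$ an edge, we have $M_{p(i)l(j)}=1$; (−1) for $i\in V\sqcup E$ and an edge $j$ lying in a common face with $i\not\subset j$, we have $M_{p(i)l(j)}=-1$. A simplicial-complex proof over $\mathbb{F}$ additionally allows three operations, after which each remaining case must have an elementary simplicial-complex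 proof: - auxiliary constructions, i.e. appending rows or columns with two entries $1$ and the rest $0$, or with all entries $-1$; - case distinction, i.e. filling zero entries with $\pm1$ and discarding tautologies and cases contradicting the incidence axiom; - proof by contradiction. *)

theory Defs
  imports "HOL-Analysis.Analysis"
begin

section \<open>The projective plane and incidence theorems\<close>

text \<open>
  Points and lines of the projective plane over a field are the 1- and 2-dimensional subspaces of
  its third power; a point lies on a line iff it is contained in it as a subspace.
\<close>

definition proj_points :: "('a::field ^ 3) set set" where
  "proj_points = {P. vec.subspace P \<and> vec.dim P = 1}"

definition proj_lines :: "('a::field ^ 3) set set" where
  "proj_lines = {L. vec.subspace L \<and> vec.dim L = 2}"

text \<open>
  Matrices are functions with rows indexed by \<open>{1..m}\<close> and columns by \<open>{1..n}\<close>; values outside this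
  range are irrelevant. Explicit sizes are needed because auxiliary constructions change them.
\<close>

definition incidence_matrix :: "nat \<Rightarrow> nat \<Rightarrow> (nat \<Rightarrow> nat \<Rightarrow> int) \<Rightarrow> bool" where
  "incidence_matrix m n M \<longleftrightarrow>
     1 \<le> m \<and> 1 \<le> n \<and> (\<forall>i\<in>{1..m}. \<forall>j\<in>{1..n}. M i j \<in> {-1, 0, 1})"

text \<open>
  The type argument is the field. The entry at \<open>(1, 1)\<close> is a hypothesis like any other: the theorem
  is a tautology if it is \<open>1\<close>, and asserts that the hypotheses are inconsistent if it is \<open>-1\<close>.
\<close>

definition incidence_theorem_true ::
    "'a::field itself \<Rightarrow> nat \<Rightarrow> nat \<Rightarrow> (nat \<Rightarrow> nat \<Rightarrow> int) \<Rightarrow> bool" where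
  "incidence_theorem_true F m n M \<longleftrightarrow>
     (\<forall>(P :: nat \<Rightarrow> ('a ^ 3) set) (L :: nat \<Rightarrow> ('a ^ 3) set).
        (\<forall>i\<in>{1..m}. P i \<in> proj_points) \<longrightarrow>
        (\<forall>j\<in>{1..n}. L j \<in> proj_lines) \<longrightarrow>
        (\<forall>i\<in>{1..m}. \<forall>j\<in>{1..n}.
           (M i j = 1 \<longrightarrow> P i \<subseteq> L j) \<and> (M i j = -1 \<longrightarrow> \<not> P i \<subseteq> L j)) \<longrightarrow>
        P 1 \<subseteq> L 1)"


section \<open>Two-dimensional simplicial complexes and excision\<close>

text \<open>
  A simplex is its set of vertices. Since complexes are finite, taking natural numbers as vertices
  is no restriction. Vertices are represented by singletons, so that the disjoint union of vertices
  and edges is a plain union, and incidence of simplices is inclusion.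
\<close>

definition simplicial_complex2 :: "nat set set \<Rightarrow> bool" where
  "simplicial_complex2 K \<longleftrightarrow>
     finite K \<and>
     (\<forall>s\<in>K. finite s \<and> s \<noteq> {} \<and> card s \<le> 3) \<and>
     (\<exists>s\<in>K. card s = 3) \<and>
     (\<forall>s\<in>K. \<forall>t. t \<subseteq> s \<and> t \<noteq> {} \<longrightarrow> t \<in> K)"

definition complex_vertices :: "nat set set \<Rightarrow> nat set set" where
  "complex_vertices K = {s \<in> K. card s = 1}"

definition complex_edges :: "nat set set \<Rightarrow> nat set set" where
  "complex_edges K = {s \<in> K. card s = 2}"

definition complex_faces :: "nat set set \<Rightarrow> nat set set" where
  "complex_faces K = {s \<in> K. card s = 3}"

text \<open>
  \<open>U a b\<close> is the value on the edge \<open>{a, b}\<close> oriented from \<open>a\<close> to \<open>b\<close>; since edges and faces have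
  cardinality 2 and 3, the vertices quantified below are automatically distinct.
\<close>

definition can_be_excised :: "'a::field itself \<Rightarrow> nat set set \<Rightarrow> nat set \<Rightarrow> bool" where
  "can_be_excised F K f\<^sub>0 \<longleftrightarrow>
     (\<forall>U :: nat \<Rightarrow> nat \<Rightarrow> 'a.
        (\<forall>a b. {a, b} \<in> complex_edges K \<longrightarrow> U a b \<noteq> 0 \<and> U a b = inverse (U b a)) \<longrightarrow>
        (\<forall>a b c. {a, b, c} \<in> complex_faces K \<and> {a, b, c} \<noteq> f\<^sub>0 \<longrightarrow> U a b * U b c * U c a = 1) \<longrightarrow>
        (\<forall>a b c. {a, b, c} = f\<^sub>0 \<longrightarrow> U a b * U b c * U c a = 1))"


section \<open>Simplicial-complex proofs\<close>

text \<open>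
  The pairs \<open>i \<subset> j\<close> of the mathematical definition include \<open>i = j\<close> when \<open>i\<close> and \<open>j\<close> are both edges.
\<close>

definition elementary_sc_proof ::
    "'a::field itself \<Rightarrow> nat \<Rightarrow> nat \<Rightarrow> (nat \<Rightarrow> nat \<Rightarrow> int) \<Rightarrow>
     nat set set \<Rightarrow> (nat set \<Rightarrow> nat) \<Rightarrow> (nat set \<Rightarrow> nat) \<Rightarrow> bool" where
  "elementary_sc_proof F m n M K p l \<longleftrightarrow>
     simplicial_complex2 K \<and>
     p \<in> complex_vertices K \<union> complex_edges K \<rightarrow> {1..m} \<and>
     l \<in> complex_faces K \<union> complex_edges K \<rightarrow> {1..n} \<and>
     (\<exists>i\<^sub>0 j\<^sub>0.
        {(i, j). i \<in> complex_edges K \<and> j \<in> complex_faces K \<and> i \<subseteq> j \<and> p i = 1 \<and> l j = 1} = {(i\<^sub>0, j\<^sub>0)} \<and>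
        can_be_excised F K j\<^sub>0 \<and>
        (\<forall>i\<in>complex_edges K. \<forall>j\<in>complex_faces K.
           i \<subseteq> j \<and> (i, j) \<noteq> (i\<^sub>0, j\<^sub>0) \<longrightarrow> M (p i) (l j) = 1)) \<and>
     (\<forall>i \<in> complex_vertices K \<union> complex_edges K. \<forall>j\<in>complex_edges K.
        i \<subseteq> j \<longrightarrow> M (p i) (l j) = 1) \<and>
     (\<forall>i \<in> complex_vertices K \<union> complex_edges K. \<forall>j\<in>complex_edges K. \<forall>f\<in>complex_faces K.
        i \<subseteq> f \<and> j \<subseteq> f \<and> \<not> i \<subseteq> j \<longrightarrow> M (p i) (l j) = -1)"

definition append_row ::
    "nat \<Rightarrow> (nat \<Rightarrow> int) \<Rightarrow> (nat \<Rightarrow> nat \<Rightarrow> int) \<Rightarrow> nat \<Rightarrow> nat \<Rightarrow> int" where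
  "append_row m r M = (\<lambda>i j. if i = Suc m then r j else M i j)"

definition append_col ::
    "nat \<Rightarrow> (nat \<Rightarrow> int) \<Rightarrow> (nat \<Rightarrow> nat \<Rightarrow> int) \<Rightarrow> nat \<Rightarrow> nat \<Rightarrow> int" where
  "append_col n c M = (\<lambda>i j. if j = Suc n then c i else M i j)"

definition filling ::
    "(nat \<times> nat) set \<Rightarrow> (nat \<Rightarrow> nat \<Rightarrow> int) \<Rightarrow> (nat \<Rightarrow> nat \<Rightarrow> int) \<Rightarrow> bool" where
  "filling Z M M' \<longleftrightarrow> (\<forall>i j. if (i, j) \<in> Z then M' i j \<in> {-1, 1} else M' i j = M i j)"

definition tautology :: "(nat \<Rightarrow> nat \<Rightarrow> int) \<Rightarrow> bool" where
  "tautology M \<longleftrightarrow> M 1 1 = 1"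

text \<open>
  The incidence axiom says that two distinct points do not both lie on two distinct lines. Different
  indices may denote equal points or lines, so distinctness must be forced by the matrix: here some
  line \<open>k\<close> contains \<open>i\<close> but not \<open>i'\<close>, and some point \<open>h\<close> lies on \<open>j\<close> but not on \<open>j'\<close>.
\<close>

definition contradicts_incidence_axiom :: "nat \<Rightarrow> nat \<Rightarrow> (nat \<Rightarrow> nat \<Rightarrow> int) \<Rightarrow> bool" where
  "contradicts_incidence_axiom m n M \<longleftrightarrow>
     (\<exists>i\<in>{1..m}. \<exists>i'\<in>{1..m}. \<exists>j\<in>{1..n}. \<exists>j'\<in>{1..n}.
        M i j = 1 \<and> M i j' = 1 \<and> M i' j = 1 \<and> M i' j' = 1 \<and>
        (\<exists>k\<in>{1..n}. M i k = 1 \<and> M i' k = -1) \<and>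
        (\<exists>h\<in>{1..m}. M h j = 1 \<and> M h j' = -1))"

definition assume_negation :: "(nat \<Rightarrow> nat \<Rightarrow> int) \<Rightarrow> nat \<Rightarrow> nat \<Rightarrow> int" where
  "assume_negation M = (\<lambda>i j. if (i, j) = (1, 1) then -1 else M i j)"

definition make_conclusion ::
    "nat \<Rightarrow> nat \<Rightarrow> (nat \<Rightarrow> nat \<Rightarrow> int) \<Rightarrow> nat \<Rightarrow> nat \<Rightarrow> int" where
  "make_conclusion r s M =
     (\<lambda>i j. M (Transposition.transpose 1 r i) (Transposition.transpose 1 s j))"

text \<open>
  The three operations may be applied any number of times in any order; the leaves are elementary
  proofs. In a proof by contradiction one assumes that the first point is not on the first line and
  derives an incidence \<open>(r, s)\<close> that the hypotheses, including the assumption, forbid. Rows and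
  columns are exchanged so that this incidence becomes the conclusion; its entry stays \<open>-1\<close>, which
  does not affect the truth of the theorem. The choice \<open>(r, s) = (1, 1)\<close> just adds the assumption.
\<close>

inductive sc_proof :: "'a::field itself \<Rightarrow> nat \<Rightarrow> nat \<Rightarrow> (nat \<Rightarrow> nat \<Rightarrow> int) \<Rightarrow> bool"
  for F :: "'a::field itself" where
  elementary:
    "elementary_sc_proof F m n M K p l \<Longrightarrow> sc_proof F m n M"
| line_through_two_points:
    "i \<in> {1..m} \<Longrightarrow> i' \<in> {1..m} \<Longrightarrow> i \<noteq> i' \<Longrightarrow>
     sc_proof F m (Suc n) (append_col n (\<lambda>k. if k \<in> {i, i'} then 1 else 0) M) \<Longrightarrow>
     sc_proof F m n M"
| point_on_two_lines:
    "j \<in> {1..n} \<Longrightarrow> j' \<in> {1..n} \<Longrightarrow> j \<noteq> j' \<Longrightarrow>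
     sc_proof F (Suc m) n (append_row m (\<lambda>k. if k \<in> {j, j'} then 1 else 0) M) \<Longrightarrow>
     sc_proof F m n M"
| generic_line:
    "sc_proof F m (Suc n) (append_col n (\<lambda>_. -1) M) \<Longrightarrow> sc_proof F m n M"
| generic_point:
    "sc_proof F (Suc m) n (append_row m (\<lambda>_. -1) M) \<Longrightarrow> sc_proof F m n M"
| case_distinction:
    "Z \<subseteq> {(i, j). i \<in> {1..m} \<and> j \<in> {1..n} \<and> M i j = 0} \<Longrightarrow>
     (\<And>M'. filling Z M M' \<Longrightarrow> \<not> tautology M' \<Longrightarrow> \<not> contradicts_incidence_axiom m n M' \<Longrightarrow>
        sc_proof F m n M') \<Longrightarrow>
     sc_proof F m n M"
| contradiction:
    "r \<in> {1..m} \<Longrightarrow> s \<in> {1..n} \<Longrightarrow> assume_negation M r s = -1 \<Longrightarrow>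
     sc_proof F m n (make_conclusion r s (assume_negation M)) \<Longrightarrow>
     sc_proof F m n M"

end

theory Submission
  imports Defs
begin

text \<open>
  Represent points by vectors and lines by covectors of \<open>F^3\<close>. In an elementary proof every face is
  mapped to a nondegenerate triangle with vertices \<open>A\<close>, \<open>B\<close>, \<open>C\<close>, and the point on the edge \<open>ab\<close>
  is \<open>A - u B\<close> up to scaling. The number \<open>U(ab) = u\<close> depends only on the oriented edge, and by
  Menelaus' theorem the three edge points of a face are collinear iff \<open>U(ab) U(bc) U(ca) = 1\<close>.
  Hence excision is exactly the step from all other faces to the distinguished one. The
  remaining operations preserve truth configuration by configuration; infinity of the field is
  needed only for a point outside finitely many lines, found on a conic, and the dual statement.
\<close>

section \<open>Homogeneous coordinates\<close>

definition dot3 :: "'a::field ^ 3 \<Rightarrow> 'a ^ 3 \<Rightarrow> 'a" where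
  "dot3 u v = u$1 * v$1 + u$2 * v$2 + u$3 * v$3"

definition det3 :: "'a::field ^ 3 \<Rightarrow> 'a ^ 3 \<Rightarrow> 'a ^ 3 \<Rightarrow> 'a" where
  "det3 u v w = u$1 * (v$2 * w$3 - v$3 * w$2) - u$2 * (v$1 * w$3 - v$3 * w$1)
    + u$3 * (v$1 * w$2 - v$2 * w$1)"

definition cross :: "'a::field ^ 3 \<Rightarrow> 'a ^ 3 \<Rightarrow> 'a ^ 3" where
  "cross u v = vector [u$2 * v$3 - u$3 * v$2, u$3 * v$1 - u$1 * v$3, u$1 * v$2 - u$2 * v$1]"

lemma dot3_commute: "dot3 u v = dot3 v u"
  by (simp add: dot3_def mult.commute)

lemma dot3_add_right: "dot3 u (v + w) = dot3 u v + dot3 u w"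
  by (simp add: dot3_def algebra_simps)

lemma dot3_diff_right: "dot3 u (v - w) = dot3 u v - dot3 u w"
  by (simp add: dot3_def algebra_simps)

lemma dot3_smult_right: "dot3 u (c *s v) = c * dot3 u v"
  by (simp add: dot3_def algebra_simps)

lemma dot3_zero_right [simp]: "dot3 u 0 = 0"
  by (simp add: dot3_def)

lemmas dot3_linear = dot3_add_right dot3_diff_right dot3_smult_right

lemma dot3_cross [simp]: "dot3 (cross u v) u = 0" "dot3 (cross u v) v = 0"
  by (simp_all add: dot3_def cross_def algebra_simps)

text \<open>The nine pairings form the product of one matrix with the transpose of the other, and
  determinants are multiplicative. This reads independence off from incidences.\<close>

lemma det3_dot3:
  fixes l m n u v w :: "'a::field ^ 3"
  shows
  "det3 l m n * det3 u v w =
     dot3 l u * (dot3 m v * dot3 n w - dot3 m w * dot3 n v)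
   - dot3 l v * (dot3 m u * dot3 n w - dot3 m w * dot3 n u)
   + dot3 l w * (dot3 m u * dot3 n v - dot3 m v * dot3 n u)"
proof -
  have det: "det3 x y z = det (vector [x, y, z])" for x y z :: "'a ^ 3"
    by (simp add: det3_def det_3 algebra_simps)
  let ?A = "vector [l, m, n] :: 'a ^ 3 ^ 3" and ?B = "vector [u, v, w] :: 'a ^ 3 ^ 3"
  have "(?A ** transpose ?B) $ i $ j = dot3 (?A $ i) (?B $ j)" for i j
    by (simp add: matrix_matrix_mult_def transpose_def dot3_def sum_3)
  then have "det (?A ** transpose ?B) =
     dot3 l u * (dot3 m v * dot3 n w - dot3 m w * dot3 n v)
   - dot3 l v * (dot3 m u * dot3 n w - dot3 m w * dot3 n u)
   + dot3 l w * (dot3 m u * dot3 n v - dot3 m v * dot3 n u)"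
    by (simp add: det_3 algebra_simps)
  then show ?thesis
    by (simp add: det det_mul det_transpose)
qed

text \<open>Cramer's rule: each coordinate of \<open>x\<close>, multiplied by the determinant, is a
  combination of the three pairings with cofactors as coefficients.\<close>

lemma zero_if_dot3_zero:
  assumes "det3 l m n \<noteq> 0" "dot3 l x = 0" "dot3 m x = 0" "dot3 n x = 0"
  shows "x = 0"
proof -
  have "det3 l m n * x$1 = 0" "det3 l m n * x$2 = 0" "det3 l m n * x$3 = 0"
    using assms(2-4) unfolding det3_def dot3_def by algebra+
  then show ?thesis
    using assms(1) by (simp add: vec_eq_iff forall_3)
qed

lemma subspace_dot3_kernel: "vec.subspace {x. dot3 u x = 0}"
  by (auto intro!: vec.subspaceI simp: dot3_linear)

lemma dot3_witness:
  assumes "u \<noteq> 0"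
  obtains e where "dot3 u e \<noteq> 0"
proof -
  have "dot3 u (axis 1 1) = u$1" "dot3 u (axis 2 1) = u$2" "dot3 u (axis 3 1) = u$3"
    by (simp_all add: dot3_def axis_def)
  with assms show thesis
    using that by (metis vec_eq_iff exhaust_3 zero_index)
qed

lemma cross_eq_zero:
  assumes "cross u v = 0" "u \<noteq> 0"
  shows "v \<in> vec.span {u}"
proof -
  have eqs: "u$2 * v$3 = u$3 * v$2" "u$3 * v$1 = u$1 * v$3" "u$1 * v$2 = u$2 * v$1"
    using assms(1) by (simp_all add: cross_def vec_eq_iff forall_3)
  obtain i where i: "u$i \<noteq> 0"
    using assms(2) by (auto simp: vec_eq_iff)
  have cross: "u$i * v$j = v$i * u$j" for j
    using eqs exhaust_3[of i] exhaust_3[of j] by (auto simp: mult.commute)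
  have "v = (v$i / u$i) *s u"
    using i cross by (simp add: vec_eq_iff field_simps)
  then show ?thesis
    by (metis vec.span_breakdown_eq vec.span_base vec.span_scale singletonI)
qed

section \<open>Points as spans of vectors, lines as kernels of covectors\<close>

lemma proj_point_span:
  assumes "P \<in> proj_points"
  obtains v where "v \<noteq> 0" "P = vec.span {v}"
proof -
  from assms have P: "vec.subspace P" "vec.dim P = 1"
    by (auto simp: proj_points_def)
  obtain B where B: "B \<subseteq> P" "vec.independent B" "P \<subseteq> vec.span B" "card B = vec.dim P"
    using vec.basis_exists by blast
  from B(4) P(2) obtain v where v: "B = {v}"
    by (metis card_1_singletonE)
  have "v \<noteq> 0"
    using B(2) v vec.dependent_zero by blast
  moreover have "P = vec.span {v}"
    using B v P(1) vec.span_minimal by blast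
  ultimately show thesis
    by (rule that)
qed

text \<open>The cross product of a basis of \<open>L\<close> is the required covector: its kernel
  contains \<open>L\<close> and is proper, so both have dimension 2.\<close>

lemma proj_line_kernel:
  fixes L :: "('a::field ^ 3) set"
  assumes "L \<in> proj_lines"
  obtains u where "u \<noteq> 0" "L = {x. dot3 u x = 0}"
proof -
  from assms have L: "vec.subspace L" "vec.dim L = 2"
    by (auto simp: proj_lines_def)
  obtain B where B: "B \<subseteq> L" "vec.independent B" "L \<subseteq> vec.span B" "card B = vec.dim L"
    using vec.basis_exists by blast
  from B(4) L(2) obtain a b where ab: "B = {a, b}" "a \<noteq> b"
    by (metis card_2_iff)
  let ?u = "cross a b"
  let ?K = "{x. dot3 ?u x = 0}"
  have "a \<noteq> 0"
    using B(2) ab vec.dependent_zero by blast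
  moreover have "b \<notin> vec.span {a}"
    using B(2) ab vec.independent_insert[of b "{a}"] by (auto simp: insert_commute)
  ultimately have u: "?u \<noteq> 0"
    using cross_eq_zero by blast
  have "vec.span B \<subseteq> ?K"
    using ab by (intro vec.span_minimal subspace_dot3_kernel) auto
  then have sub: "L \<subseteq> ?K"
    using B(3) by blast
  obtain e where e: "dot3 ?u e \<noteq> 0"
    using dot3_witness[OF u] .
  have "vec.dim ?K < 3"
  proof (rule ccontr)
    assume "\<not> vec.dim ?K < 3"
    then have "?K = UNIV"
      using vec.subspace_dim_equal[OF subspace_dot3_kernel vec.subspace_UNIV, of ?u]
      by (simp add: vec_dim_card del: vec.dim_UNIV)
    with e show False
      by blast
  qed
  then have "L = ?K"
    using vec.subspace_dim_equal[OF L(1) subspace_dot3_kernel sub] L(2) by simp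
  with u show thesis
    by (rule that)
qed

lemma span_subset_kernel_iff: "vec.span {v} \<subseteq> {x. dot3 u x = 0} \<longleftrightarrow> dot3 u v = 0"
proof
  assume "vec.span {v} \<subseteq> {x. dot3 u x = 0}"
  then show "dot3 u v = 0"
    using vec.span_base by blast
next
  assume "dot3 u v = 0"
  then show "vec.span {v} \<subseteq> {x. dot3 u x = 0}"
    by (intro vec.span_minimal subspace_dot3_kernel) auto
qed

section \<open>Existence of auxiliary points and lines\<close>

text \<open>Different indices may denote the same point or line, so the cross product can vanish;
  then any nonzero covector orthogonal to one spanning vector serves.\<close>

lemma nonzero_orthogonal_to_two:
  fixes u v :: "'a::field ^ 3"
  obtains w where "w \<noteq> 0" "dot3 w u = 0" "dot3 w v = 0"
proof (cases "cross u v = 0")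
  case False
  then show ?thesis
    using that dot3_cross by blast
next
  case True
  have orth: "\<exists>w. w \<noteq> 0 \<and> dot3 w x = 0" for x :: "'a ^ 3"
  proof (cases "x$1 = 0 \<and> x$2 = 0")
    case True
    then show ?thesis
      by (intro exI[of _ "vector [1, 0, 0]"]) (simp add: dot3_def vec_eq_iff forall_3)
  next
    case False
    then show ?thesis
      by (intro exI[of _ "vector [x$2, - x$1, 0]"]) (auto simp: dot3_def vec_eq_iff forall_3)
  qed
  show ?thesis
  proof (cases "u = 0")
    case True
    then show ?thesis
      using orth[of v] that by auto
  next
    case False
    obtain w where w: "w \<noteq> 0" "dot3 w u = 0"
      using orth[of u] by blast
    have "vec.span {u} \<subseteq> {x. dot3 w x = 0}"
      using w(2) span_subset_kernel_iff by blast
    then have "dot3 w v = 0"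
      using cross_eq_zero[OF True False] by blast
    with w show ?thesis
      using that by blast
  qed
qed

lemma exists_generic_vector:
  fixes S :: "('a::field ^ 3) set"
  assumes inf: "infinite (UNIV :: 'a set)" and "finite S" "0 \<notin> S"
  obtains w where "w \<noteq> 0" "\<And>s. s \<in> S \<Longrightarrow> dot3 s w \<noteq> 0"
proof -
  define q :: "'a ^ 3 \<Rightarrow> 'a poly" where "q s = [:s$1, s$2, s$3:]" for s
  have "finite {t. poly (q s) t = 0}" if "s \<in> S" for s
  proof (rule poly_roots_finite)
    have "s \<noteq> 0"
      using that assms(3) by blast
    then show "q s \<noteq> 0"
      by (auto simp: q_def vec_eq_iff forall_3)
  qed
  with \<open>finite S\<close> have "finite (\<Union>s\<in>S. {t. poly (q s) t = 0})"
    by blast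
  with inf obtain t where t: "t \<notin> (\<Union>s\<in>S. {t. poly (q s) t = 0})"
    using ex_new_if_finite by blast
  \<comment> \<open>On this conic, pairing with \<open>s\<close> is a polynomial in \<open>t\<close>
    whose coefficients are the coordinates of \<open>s\<close>; hence only finitely many values of
    \<open>t\<close> are bad.\<close>
  define w :: "'a ^ 3" where "w = vector [1, t, t * t]"
  have "w $ 1 \<noteq> 0"
    by (simp add: w_def)
  then have "w \<noteq> 0"
    by auto
  moreover have "dot3 s w = poly (q s) t" for s
    by (simp add: dot3_def w_def q_def algebra_simps)
  then have "dot3 s w \<noteq> 0" if "s \<in> S" for s
    using t that by auto
  ultimately show thesis
    by (rule that)
qed


section \<open>Configurations\<close>

definition configuration ::
    "nat \<Rightarrow> nat \<Rightarrow> (nat \<Rightarrow> nat \<Rightarrow> int) \<Rightarrow> (nat \<Rightarrow> 'a::field ^ 3) \<Rightarrow> (nat \<Rightarrow> 'a ^ 3) \<Rightarrow> bool" where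
  "configuration m n M P L \<longleftrightarrow>
     (\<forall>i\<in>{1..m}. P i \<noteq> 0) \<and> (\<forall>j\<in>{1..n}. L j \<noteq> 0) \<and>
     (\<forall>i\<in>{1..m}. \<forall>j\<in>{1..n}.
        (M i j = 1 \<longrightarrow> dot3 (L j) (P i) = 0) \<and> (M i j = -1 \<longrightarrow> dot3 (L j) (P i) \<noteq> 0))"

lemma incidence_theorem_trueI:
  fixes F :: "'a::field itself"
  assumes "1 \<le> m" "1 \<le> n"
    and vec: "\<And>(P :: nat \<Rightarrow> 'a ^ 3) L. configuration m n M P L \<Longrightarrow> dot3 (L 1) (P 1) = 0"
  shows "incidence_theorem_true F m n M"
  unfolding incidence_theorem_true_def
proof (intro allI impI)
  fix P L :: "nat \<Rightarrow> ('a ^ 3) set"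
  assume P: "\<forall>i\<in>{1..m}. P i \<in> proj_points" and L: "\<forall>j\<in>{1..n}. L j \<in> proj_lines"
    and M: "\<forall>i\<in>{1..m}. \<forall>j\<in>{1..n}.
      (M i j = 1 \<longrightarrow> P i \<subseteq> L j) \<and> (M i j = -1 \<longrightarrow> \<not> P i \<subseteq> L j)"
  have "\<exists>v. v \<noteq> 0 \<and> P i = vec.span {v}" if "i \<in> {1..m}" for i
    using P that proj_point_span by metis
  then obtain v where v: "\<And>i. i \<in> {1..m} \<Longrightarrow> v i \<noteq> 0 \<and> P i = vec.span {v i}"
    by metis
  have "\<exists>u. u \<noteq> 0 \<and> L j = {x. dot3 u x = 0}" if "j \<in> {1..n}" for j
    using L that proj_line_kernel by metis
  then obtain u where u: "\<And>j. j \<in> {1..n} \<Longrightarrow> u j \<noteq> 0 \<and> L j = {x. dot3 (u j) x = 0}"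
    by metis
  have inc: "P i \<subseteq> L j \<longleftrightarrow> dot3 (u j) (v i) = 0" if "i \<in> {1..m}" "j \<in> {1..n}" for i j
    using u[OF that(2)] v[OF that(1)] span_subset_kernel_iff by metis
  have "configuration m n M v u"
    unfolding configuration_def using M inc u v by metis
  then have "dot3 (u 1) (v 1) = 0"
    by (rule vec)
  then show "P 1 \<subseteq> L 1"
    using inc assms(1,2) by simp
qed


section \<open>Elementary proofs\<close>

text \<open>\<open>P\<close> and \<open>L\<close> stand for a configuration already composed with
  the labels of simplices. Incidences of edge points with face lines are left out: the distinguished
  one is the goal, and the others enter in \<open>excision_incidence\<close>.\<close>

locale realized_complex =
  fixes K :: "nat set set" and P L :: "nat set \<Rightarrow> 'a::field ^ 3"
  assumes complex: "simplicial_complex2 K"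
    and on_line: "\<lbrakk>i \<in> complex_vertices K \<union> complex_edges K; j \<in> complex_edges K; i \<subseteq> j\<rbrakk>
      \<Longrightarrow> dot3 (L j) (P i) = 0"
    and off_line: "\<lbrakk>i \<in> complex_vertices K \<union> complex_edges K; j \<in> complex_edges K;
      f \<in> complex_faces K; i \<subseteq> f; j \<subseteq> f; \<not> i \<subseteq> j\<rbrakk> \<Longrightarrow> dot3 (L j) (P i) \<noteq> 0"
    and face_line: "f \<in> complex_faces K \<Longrightarrow> L f \<noteq> 0"
begin

lemma face_parts:
  assumes "{a, b, c} \<in> complex_faces K"
  shows "a \<noteq> b" "b \<noteq> c" "a \<noteq> c"
    and "{a} \<in> complex_vertices K" "{b} \<in> complex_vertices K" "{c} \<in> complex_vertices K"
    and "{a, b} \<in> complex_edges K" "{b, c} \<in> complex_edges K" "{a, c} \<in> complex_edges K"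
proof -
  from assms have f: "{a, b, c} \<in> K" "card {a, b, c} = 3"
    by (auto simp: complex_faces_def)
  then show ne: "a \<noteq> b" "b \<noteq> c" "a \<noteq> c"
    by (auto simp: card_insert_if split: if_splits)
  have sub: "t \<in> K" if "t \<subseteq> {a, b, c}" "t \<noteq> {}" for t
    using complex f that unfolding simplicial_complex2_def by blast
  show "{a} \<in> complex_vertices K" "{b} \<in> complex_vertices K" "{c} \<in> complex_vertices K"
    unfolding complex_vertices_def using sub by simp_all
  show "{a, b} \<in> complex_edges K" "{b, c} \<in> complex_edges K" "{a, c} \<in> complex_edges K"
    unfolding complex_edges_def using sub ne by simp_all
qed

lemma triangle:
  assumes "{a, b, c} \<in> complex_faces K"
  shows "dot3 (L {a, b}) (P {a}) = 0" "dot3 (L {a, b}) (P {b}) = 0"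
    and "dot3 (L {a, b}) (P {a, b}) = 0"
    and "dot3 (L {a, b}) (P {c}) \<noteq> 0"
    and "dot3 (L {b, c}) (P {a, b}) \<noteq> 0" "dot3 (L {a, c}) (P {a, b}) \<noteq> 0"
  using face_parts[OF assms] assms
  by (simp_all add: on_line off_line[where f = "{a, b, c}"])

text \<open>Pairing the sides with their opposite vertices gives a diagonal matrix with nonzero
  diagonal, so both determinants are nonzero.\<close>

lemma triangle_det:
  assumes "{a, b, c} \<in> complex_faces K"
  shows "det3 (L {b, c}) (L {a, c}) (L {a, b}) \<noteq> 0" "det3 (P {a}) (P {b}) (P {c}) \<noteq> 0"
proof -
  have perms: "{b, c, a} \<in> complex_faces K" "{a, c, b} \<in> complex_faces K"
    using assms by (simp_all add: insert_commute)
  note t = triangle[OF assms] triangle[OF perms(1)] triangle[OF perms(2)]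
  have "det3 (L {b, c}) (L {a, c}) (L {a, b}) * det3 (P {a}) (P {b}) (P {c}) =
      dot3 (L {b, c}) (P {a}) * (dot3 (L {a, c}) (P {b}) * dot3 (L {a, b}) (P {c}))"
    using t by (simp add: det3_dot3)
  moreover have "\<dots> \<noteq> 0"
    using t by simp
  ultimately show "det3 (L {b, c}) (L {a, c}) (L {a, b}) \<noteq> 0"
      "det3 (P {a}) (P {b}) (P {c}) \<noteq> 0"
    by auto
qed

section \<open>Edge ratios\<close>

text \<open>The factor \<open>x\<close> absorbs the scale of the edge vector. The ratio
  \<open>u\<close> depends on the scales of the two vertices, but these cancel around a face; the
  minus sign makes the product in Menelaus' theorem 1 instead of -1.\<close>

definition edge_ratio :: "nat \<Rightarrow> nat \<Rightarrow> 'a \<Rightarrow> bool" where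
  "edge_ratio a b u \<longleftrightarrow>
     u \<noteq> 0 \<and> (\<exists>x. x \<noteq> 0 \<and> P {a, b} = x *s (P {a} - u *s P {b}))"

lemma edge_ratio_exists:
  assumes "{a, b, c} \<in> complex_faces K"
  shows "\<exists>u. edge_ratio a b u"
proof -
  have perms: "{b, c, a} \<in> complex_faces K" "{a, c, b} \<in> complex_faces K"
    using assms by (simp_all add: insert_commute)
  note t = triangle[OF assms] triangle[OF perms(1)] triangle[OF perms(2)]
  \<comment> \<open>The coordinates of the edge point with respect to the vertices \<open>a\<close>
    and \<open>b\<close>: each is read off by the side through the other vertex and
    \<open>c\<close>. They are nonzero because the edge point avoids these sides.\<close>
  define x where "x = dot3 (L {b, c}) (P {a, b}) / dot3 (L {b, c}) (P {a})"
  define y where "y = dot3 (L {a, c}) (P {a, b}) / dot3 (L {a, c}) (P {b})"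
  have xy: "x \<noteq> 0" "y \<noteq> 0"
    using t by (simp_all add: x_def y_def)
  let ?d = "P {a, b} - (x *s P {a} + y *s P {b})"
  \<comment> \<open>The sides \<open>bc\<close> and \<open>ac\<close> annihilate the difference by
    the choice of \<open>x\<close> and \<open>y\<close>, and \<open>ab\<close> does because all
    three points lie on it.\<close>
  have "?d = 0"
    using t by (intro zero_if_dot3_zero[OF triangle_det(1)[OF assms]])
      (simp_all add: dot3_linear x_def y_def)
  then have "P {a, b} = x *s P {a} + y *s P {b}"
    by simp
  also have "\<dots> = x *s (P {a} - (- y / x) *s P {b})"
    using xy by (simp add: vec_eq_iff field_simps)
  finally show ?thesis
    unfolding edge_ratio_def using xy by (intro exI[of _ "- y / x"]) auto
qed

text \<open>Pairing both representations with side \<open>bc\<close> identifies the scale factors,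
  and then side \<open>ac\<close> identifies the ratios. This makes the ratios chosen for the two
  orientations of an edge inverse to each other.\<close>

lemma edge_ratio_unique:
  assumes "{a, b, c} \<in> complex_faces K" "edge_ratio a b u" "edge_ratio a b v"
  shows "u = v"
proof -
  have perms: "{b, c, a} \<in> complex_faces K" "{a, c, b} \<in> complex_faces K"
    using assms(1) by (simp_all add: insert_commute)
  note t = triangle[OF assms(1)] triangle[OF perms(1)] triangle[OF perms(2)]
  obtain x y where x: "x \<noteq> 0" "P {a, b} = x *s (P {a} - u *s P {b})"
    and y: "y \<noteq> 0" "P {a, b} = y *s (P {a} - v *s P {b})"
    using assms(2,3) unfolding edge_ratio_def by blast
  have "dot3 (L {b, c}) (P {a, b}) = x * dot3 (L {b, c}) (P {a})"
    unfolding x(2) using t by (simp add: dot3_linear)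
  moreover have "dot3 (L {b, c}) (P {a, b}) = y * dot3 (L {b, c}) (P {a})"
    unfolding y(2) using t by (simp add: dot3_linear)
  ultimately have "x = y"
    using t by simp
  have "dot3 (L {a, c}) (P {a, b}) = - (x * u * dot3 (L {a, c}) (P {b}))"
    unfolding x(2) using t by (simp add: dot3_linear)
  moreover have "dot3 (L {a, c}) (P {a, b}) = - (y * v * dot3 (L {a, c}) (P {b}))"
    unfolding y(2) using t by (simp add: dot3_linear)
  ultimately show ?thesis
    using t x(1) \<open>x = y\<close> by simp
qed

lemma edge_ratio_inverse:
  assumes "edge_ratio a b u"
  shows "edge_ratio b a (inverse u)"
proof -
  obtain x where x: "u \<noteq> 0" "x \<noteq> 0" "P {a, b} = x *s (P {a} - u *s P {b})"
    using assms unfolding edge_ratio_def by blast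
  have "P {b, a} = P {a, b}"
    by (simp add: insert_commute)
  also have "\<dots> = (- x * u) *s (P {b} - inverse u *s P {a})"
    using x by (simp add: vec_eq_iff field_simps)
  finally show ?thesis
    unfolding edge_ratio_def using x(1,2)
    by (metis inverse_nonzero_iff_nonzero mult_eq_0_iff neg_equal_0_iff_equal)
qed

text \<open>Here \<open>f\<close> is a covector. Incidence becomes a multiplicative relation between
  its values at the endpoints, which reduces both directions of Menelaus' theorem to
  algebra.\<close>

lemma dot3_edge_point_eq_zero:
  assumes "edge_ratio a b u"
  shows "dot3 f (P {a, b}) = 0 \<longleftrightarrow> dot3 f (P {a}) = u * dot3 f (P {b})"
  using assms by (auto simp: edge_ratio_def dot3_linear)

text \<open>Edges outside all faces may be degenerate; the value \<open>1\<close> is a placeholder for them.\<close>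

definition ratio :: "nat \<Rightarrow> nat \<Rightarrow> 'a" where
  "ratio a b = (if \<exists>c. {a, b, c} \<in> complex_faces K then SOME u. edge_ratio a b u else 1)"

lemma edge_ratio_ratio:
  assumes "{a, b, c} \<in> complex_faces K"
  shows "edge_ratio a b (ratio a b)"
  using assms someI_ex[OF edge_ratio_exists[OF assms]] unfolding ratio_def by auto

lemma ratio_inverse: "ratio a b \<noteq> 0 \<and> ratio a b = inverse (ratio b a)"
proof (cases "\<exists>c. {a, b, c} \<in> complex_faces K")
  case True
  then obtain c where c: "{a, b, c} \<in> complex_faces K" "{b, a, c} \<in> complex_faces K"
    by (auto simp: insert_commute)
  have "ratio a b = inverse (ratio b a)"
    using edge_ratio_unique[OF c(1) edge_ratio_ratio[OF c(1)]]
      edge_ratio_inverse[OF edge_ratio_ratio[OF c(2)]] by blast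
  moreover have "ratio a b \<noteq> 0"
    using edge_ratio_ratio[OF c(1)] unfolding edge_ratio_def by blast
  ultimately show ?thesis
    by blast
next
  case False
  then have "\<not> (\<exists>c. {b, a, c} \<in> complex_faces K)"
    by (simp add: insert_commute)
  with False show ?thesis
    unfolding ratio_def by simp
qed

section \<open>Menelaus' theorem and excision\<close>

text \<open>Going once around the triangle multiplies the value of \<open>g\<close> at
  \<open>a\<close> by the product of ratios. Were this not 1, \<open>g\<close> would vanish at three
  independent vertices.\<close>

lemma menelaus:
  assumes f: "{a, b, c} \<in> complex_faces K" and "g \<noteq> 0"
    and "dot3 g (P {a, b}) = 0" "dot3 g (P {b, c}) = 0" "dot3 g (P {c, a}) = 0"
  shows "ratio a b * ratio b c * ratio c a = 1"
proof (rule ccontr)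
  assume ne: "ratio a b * ratio b c * ratio c a \<noteq> 1"
  have perms: "{b, c, a} \<in> complex_faces K" "{c, a, b} \<in> complex_faces K"
    using f by (simp_all add: insert_commute)
  note e = edge_ratio_ratio[OF f] edge_ratio_ratio[OF perms(1)] edge_ratio_ratio[OF perms(2)]
  have eqs: "dot3 g (P {a}) = ratio a b * dot3 g (P {b})"
    "dot3 g (P {b}) = ratio b c * dot3 g (P {c})"
    "dot3 g (P {c}) = ratio c a * dot3 g (P {a})"
    using assms(3-5) e by (simp_all add: dot3_edge_point_eq_zero)
  then have "(1 - ratio a b * ratio b c * ratio c a) * dot3 g (P {a}) = 0"
    by algebra
  then have "dot3 g (P {a}) = 0"
    using ne by simp
  with eqs have "dot3 (P {a}) g = 0" "dot3 (P {b}) g = 0" "dot3 (P {c}) g = 0"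
    by (simp_all add: dot3_commute)
  then have "g = 0"
    using zero_if_dot3_zero[OF triangle_det(2)[OF f]] by blast
  with \<open>g \<noteq> 0\<close> show False
    by blast
qed

lemma menelaus_converse:
  assumes f: "{a, b, c} \<in> complex_faces K"
    and "dot3 g (P {a, b}) = 0" "dot3 g (P {b, c}) = 0"
    and "ratio a b * ratio b c * ratio c a = 1"
  shows "dot3 g (P {c, a}) = 0"
proof -
  have perms: "{b, c, a} \<in> complex_faces K" "{c, a, b} \<in> complex_faces K"
    using f by (simp_all add: insert_commute)
  note e = edge_ratio_ratio[OF f] edge_ratio_ratio[OF perms(1)] edge_ratio_ratio[OF perms(2)]
  have "dot3 g (P {a}) = ratio a b * dot3 g (P {b})"
    "dot3 g (P {b}) = ratio b c * dot3 g (P {c})"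
    using assms(2,3) e by (simp_all add: dot3_edge_point_eq_zero)
  then have "dot3 g (P {c}) = ratio c a * dot3 g (P {a})"
    using assms(4) by algebra
  with e show ?thesis
    by (simp add: dot3_edge_point_eq_zero)
qed

lemma excision_incidence:
  fixes F :: "'a itself"
  assumes excise: "can_be_excised F K f"
    and i: "i \<in> complex_edges K" and f: "f \<in> complex_faces K" and "i \<subseteq> f"
    and other: "\<And>i' f'. \<lbrakk>i' \<in> complex_edges K; f' \<in> complex_faces K; i' \<subseteq> f'; (i', f') \<noteq> (i, f)\<rbrakk>
      \<Longrightarrow> dot3 (L f') (P i') = 0"
  shows "dot3 (L f) (P i) = 0"
proof -
  \<comment> \<open>The vertices are labelled so that the distinguished edge is the one that
    \<open>menelaus_converse\<close> concludes about.\<close>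
  obtain c a where ca: "i = {c, a}" "c \<noteq> a"
    using i unfolding complex_edges_def by (auto simp: card_2_iff)
  have "card f = 3"
    using f by (simp add: complex_faces_def)
  then have "card (f - i) = 1"
    using \<open>i \<subseteq> f\<close> ca by (simp add: card_Diff_subset)
  then obtain b where b: "f - i = {b}"
    by (metis card_1_singletonE)
  then have f_eq: "f = {a, b, c}"
    using \<open>i \<subseteq> f\<close> ca by auto
  note parts = face_parts[OF f[unfolded f_eq]]
  have prod: "ratio x y * ratio y z * ratio z x = 1"
    if "{x, y, z} \<in> complex_faces K \<and> {x, y, z} \<noteq> f" for x y z
  proof (rule menelaus)
    show xyz: "{x, y, z} \<in> complex_faces K"
      using that by blast
    show "L {x, y, z} \<noteq> 0"
      using face_line[OF xyz] .
    show "dot3 (L {x, y, z}) (P {x, y}) = 0" "dot3 (L {x, y, z}) (P {y, z}) = 0"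
      "dot3 (L {x, y, z}) (P {z, x}) = 0"
      \<comment> \<open>As the face differs from \<open>f\<close>, none of its edges forms the
        distinguished pair with it.\<close>
      using that face_parts[OF xyz] by (auto intro!: other simp: insert_commute)
  qed
  have "ratio a b * ratio b c * ratio c a = 1"
    by (rule excise[unfolded can_be_excised_def, rule_format, OF ratio_inverse prod])
      (simp_all add: f_eq)
  \<comment> \<open>Within \<open>f\<close> itself only the edge \<open>i\<close> is
    exceptional.\<close>
  moreover have "dot3 (L f) (P {a, b}) = 0" "dot3 (L f) (P {b, c}) = 0"
    using parts f f_eq ca by (auto intro!: other simp: doubleton_eq_iff)
  ultimately show ?thesis
    using menelaus_converse f f_eq ca by blast
qed

end

text \<open>Composing the configuration with \<open>p\<close> and \<open>l\<close> realizes the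
  complex. The distinguished pair is labelled 1 and 1, so the incidence gained by excision is the
  conclusion.\<close>

lemma elementary_sc_proof_sound:
  fixes F :: "'a::field itself" and P L :: "nat \<Rightarrow> 'a ^ 3"
  assumes elem: "elementary_sc_proof F m n M K p l" and config: "configuration m n M P L"
  shows "dot3 (L 1) (P 1) = 0"
proof -
  obtain i0 j0 where complex: "simplicial_complex2 K"
    and p_range: "p \<in> complex_vertices K \<union> complex_edges K \<rightarrow> {1..m}"
    and l_range: "l \<in> complex_faces K \<union> complex_edges K \<rightarrow> {1..n}"
    and ij0: "{(i, j). i \<in> complex_edges K \<and> j \<in> complex_faces K \<and> i \<subseteq> j \<and> p i = 1 \<and> l j = 1}
      = {(i0, j0)}"
    and excise: "can_be_excised F K j0"
    and other: "\<forall>i\<in>complex_edges K. \<forall>j\<in>complex_faces K.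
      i \<subseteq> j \<and> (i, j) \<noteq> (i0, j0) \<longrightarrow> M (p i) (l j) = 1"
    and pos: "\<forall>i \<in> complex_vertices K \<union> complex_edges K. \<forall>j\<in>complex_edges K.
      i \<subseteq> j \<longrightarrow> M (p i) (l j) = 1"
    and neg: "\<forall>i \<in> complex_vertices K \<union> complex_edges K. \<forall>j\<in>complex_edges K.
      \<forall>f\<in>complex_faces K. i \<subseteq> f \<and> j \<subseteq> f \<and> \<not> i \<subseteq> j \<longrightarrow> M (p i) (l j) = -1"
    using elem unfolding elementary_sc_proof_def by (elim conjE exE) (rule that)
  have p: "p i \<in> {1..m}" if "i \<in> complex_vertices K \<union> complex_edges K" for i
    using p_range that by (rule funcset_mem)
  have l: "l j \<in> {1..n}" if "j \<in> complex_faces K \<union> complex_edges K" for j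
    using l_range that by (rule funcset_mem)
  have on: "dot3 (L (l j)) (P (p i)) = 0"
    if "i \<in> complex_vertices K \<union> complex_edges K" "j \<in> complex_faces K \<union> complex_edges K"
      "M (p i) (l j) = 1" for i j
    using config p[OF that(1)] l[OF that(2)] that(3) unfolding configuration_def by blast
  have off: "dot3 (L (l j)) (P (p i)) \<noteq> 0"
    if "i \<in> complex_vertices K \<union> complex_edges K" "j \<in> complex_faces K \<union> complex_edges K"
      "M (p i) (l j) = -1" for i j
    using config p[OF that(1)] l[OF that(2)] that(3) unfolding configuration_def by blast
  have i0j0: "i0 \<in> complex_edges K" "j0 \<in> complex_faces K" "i0 \<subseteq> j0" "p i0 = 1" "l j0 = 1"
    using eqset_imp_iff[OF ij0, of "(i0, j0)"] by simp_all
  interpret realized_complex K "\<lambda>i. P (p i)" "\<lambda>j. L (l j)"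
  proof
    show "simplicial_complex2 K"
      by (rule complex)
  next
    fix i j
    assume "i \<in> complex_vertices K \<union> complex_edges K" "j \<in> complex_edges K" "i \<subseteq> j"
    moreover from this have "M (p i) (l j) = 1"
      using pos by blast
    ultimately show "dot3 (L (l j)) (P (p i)) = 0"
      using on by blast
  next
    fix i j f
    assume ij: "i \<in> complex_vertices K \<union> complex_edges K" "j \<in> complex_edges K"
      and "f \<in> complex_faces K" "i \<subseteq> f" "j \<subseteq> f" "\<not> i \<subseteq> j"
    then have "M (p i) (l j) = -1"
      using neg by blast
    then show "dot3 (L (l j)) (P (p i)) \<noteq> 0"
      using off ij by blast
  next
    fix f
    assume "f \<in> complex_faces K"
    then show "L (l f) \<noteq> 0"
      using config l unfolding configuration_def by blast
  qed
  have "dot3 (L (l j0)) (P (p i0)) = 0"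
  proof (rule excision_incidence[OF excise i0j0(1-3)])
    fix i j
    assume ij: "i \<in> complex_edges K" "j \<in> complex_faces K" "i \<subseteq> j" "(i, j) \<noteq> (i0, j0)"
    then have "M (p i) (l j) = 1"
      using other by blast
    then show "dot3 (L (l j)) (P (p i)) = 0"
      using on ij(1,2) by blast
  qed
  then show ?thesis
    using i0j0 by simp
qed


section \<open>Soundness of the operations\<close>

lemma configuration_append_col:
  assumes "configuration m n M P L" "u \<noteq> 0"
    and "\<And>i. i \<in> {1..m} \<Longrightarrow> c i = 1 \<Longrightarrow> dot3 u (P i) = 0"
    and "\<And>i. i \<in> {1..m} \<Longrightarrow> c i = -1 \<Longrightarrow> dot3 u (P i) \<noteq> 0"
  shows "configuration m (Suc n) (append_col n c M) P (L(Suc n := u))"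
  using assms unfolding configuration_def append_col_def by (auto simp: le_Suc_eq)

lemma configuration_append_row:
  assumes "configuration m n M P L" "v \<noteq> 0"
    and "\<And>j. j \<in> {1..n} \<Longrightarrow> r j = 1 \<Longrightarrow> dot3 (L j) v = 0"
    and "\<And>j. j \<in> {1..n} \<Longrightarrow> r j = -1 \<Longrightarrow> dot3 (L j) v \<noteq> 0"
  shows "configuration (Suc m) n (append_row m r M) (P(Suc m := v)) L"
  using assms unfolding configuration_def append_row_def by (auto simp: le_Suc_eq)

lemma transpose_in_interval:
  fixes a r m :: nat
  assumes "a \<in> {1..m}" "r \<in> {1..m}" "1 \<le> m"
  shows "Transposition.transpose 1 r a \<in> {1..m}"
  using assms by (auto simp: Transposition.transpose_def)

lemma configuration_make_conclusion:
  assumes "configuration m n M P L" "r \<in> {1..m}" "s \<in> {1..n}"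
  shows "configuration m n (make_conclusion r s M)
    (\<lambda>i. P (Transposition.transpose 1 r i)) (\<lambda>j. L (Transposition.transpose 1 s j))"
proof -
  have "1 \<le> m" "1 \<le> n"
    using assms(2,3) by auto
  then show ?thesis
    using assms(1) transpose_in_interval[OF _ assms(2)] transpose_in_interval[OF _ assms(3)]
    unfolding configuration_def make_conclusion_def by blast
qed

text \<open>By \<open>k\<close> the points are distinct, so \<open>v\<close> and \<open>w\<close>
  extend to a basis; two lines through both are then proportional, which \<open>h\<close>
  forbids.\<close>

lemma two_points_on_two_lines:
  assumes "v \<noteq> 0" "l \<noteq> 0" "dot3 l v = 0" "dot3 l' v = 0" "dot3 l w = 0" "dot3 l' w = 0"
    and k: "dot3 k v = 0" "dot3 k w \<noteq> 0" and h: "dot3 l h = 0" "dot3 l' h \<noteq> 0"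
  shows False
proof -
  have c: "cross v w \<noteq> 0"
    using cross_eq_zero[of v w] assms(1) k span_subset_kernel_iff[of v k] by blast
  have "det3 v w e = dot3 (cross v w) e" for e
    by (simp add: det3_def dot3_def cross_def algebra_simps)
  then obtain e where e: "det3 v w e \<noteq> 0"
    using dot3_witness[OF c] by metis
  \<comment> \<open>This combination is chosen to vanish at \<open>e\<close>; it also vanishes at
    \<open>v\<close> and \<open>w\<close>. Evaluated at \<open>h\<close>, only the term with
    \<open>l'\<close> survives.\<close>
  have "dot3 l' e *s l - dot3 l e *s l' = 0"
    using assms(3-6) by (intro zero_if_dot3_zero[OF e])
      (simp_all add: dot3_linear dot3_commute[of _ l] dot3_commute[of _ l'] dot3_commute[of e])
  then have eq: "dot3 h (dot3 l' e *s l - dot3 l e *s l') = 0"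
    by simp
  then have "dot3 l e = 0"
    using h by (simp add: dot3_linear dot3_commute[of h])
  then have "l = 0"
    using assms(3,5) by (intro zero_if_dot3_zero[OF e]) (simp_all add: dot3_commute)
  with \<open>l \<noteq> 0\<close> show False
    by blast
qed

lemma configuration_incidence_axiom:
  assumes "configuration m n M P L"
  shows "\<not> contradicts_incidence_axiom m n M"
proof
  assume "contradicts_incidence_axiom m n M"
  then obtain i i' j j' k h where
    ij: "i \<in> {1..m}" "i' \<in> {1..m}" "j \<in> {1..n}" "j' \<in> {1..n}" "k \<in> {1..n}" "h \<in> {1..m}"
    and M: "M i j = 1" "M i j' = 1" "M i' j = 1" "M i' j' = 1" "M i k = 1" "M i' k = -1"
      "M h j = 1" "M h j' = -1"
    unfolding contradicts_incidence_axiom_def by blast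
  have on: "dot3 (L b) (P a) = 0" if "a \<in> {1..m}" "b \<in> {1..n}" "M a b = 1" for a b
    using assms that unfolding configuration_def by blast
  have off: "dot3 (L b) (P a) \<noteq> 0" if "a \<in> {1..m}" "b \<in> {1..n}" "M a b = -1" for a b
    using assms that unfolding configuration_def by blast
  have "P i \<noteq> 0" "L j \<noteq> 0"
    using assms ij unfolding configuration_def by blast+
  from two_points_on_two_lines[OF this, of "L j'" "P i'" "L k" "P h"] show False
    using ij M on off by blast
qed

lemma sc_proof_sound:
  fixes F :: "'a::field itself" and P L :: "nat \<Rightarrow> 'a ^ 3"
  assumes inf: "infinite (UNIV :: 'a set)"
    and "sc_proof F m n M" "1 \<le> m" "1 \<le> n" "configuration m n M P L"
  shows "dot3 (L 1) (P 1) = 0"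
  using assms(2-)
\<comment> \<open>The configuration must vary: auxiliary constructions extend it, and contradiction
  permutes it.\<close>
proof (induction arbitrary: P L rule: sc_proof.induct)
  case (elementary m n M K p l)
  then show ?case
    using elementary_sc_proof_sound by blast
next
  case (line_through_two_points i m i' n M)
  obtain u where "u \<noteq> 0" "dot3 u (P i) = 0" "dot3 u (P i') = 0"
    by (rule nonzero_orthogonal_to_two)
  with line_through_two_points.prems
  have "configuration m (Suc n) (append_col n (\<lambda>k. if k \<in> {i, i'} then 1 else 0) M)
      P (L(Suc n := u))"
    by (intro configuration_append_col) (auto split: if_splits)
  from line_through_two_points.IH[OF _ _ this] show ?case
    using line_through_two_points.prems by simp
next
  case (point_on_two_lines j n j' m M)
  obtain v where "v \<noteq> 0" "dot3 v (L j) = 0" "dot3 v (L j') = 0"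
    by (rule nonzero_orthogonal_to_two)
  with point_on_two_lines.prems
  have "configuration (Suc m) n (append_row m (\<lambda>k. if k \<in> {j, j'} then 1 else 0) M)
      (P(Suc m := v)) L"
    by (intro configuration_append_row) (auto simp: dot3_commute[of v] split: if_splits)
  from point_on_two_lines.IH[OF _ _ this] show ?case
    using point_on_two_lines.prems by simp
next
  case (generic_line m n M)
  have "0 \<notin> P ` {1..m}"
    using generic_line.prems(3) unfolding configuration_def by auto
  then obtain u where u: "u \<noteq> 0" "\<And>s. s \<in> P ` {1..m} \<Longrightarrow> dot3 s u \<noteq> 0"
    using exists_generic_vector[OF inf, of "P ` {1..m}"] by blast
  have "configuration m (Suc n) (append_col n (\<lambda>_. -1) M) P (L(Suc n := u))"
    using generic_line.prems(3) u by (intro configuration_append_col) (auto simp: dot3_commute[of u])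
  from generic_line.IH[OF _ _ this] show ?case
    using generic_line.prems by simp
next
  case (generic_point m n M)
  have "0 \<notin> L ` {1..n}"
    using generic_point.prems(3) unfolding configuration_def by auto
  then obtain v where v: "v \<noteq> 0" "\<And>s. s \<in> L ` {1..n} \<Longrightarrow> dot3 s v \<noteq> 0"
    using exists_generic_vector[OF inf, of "L ` {1..n}"] by blast
  have "configuration (Suc m) n (append_row m (\<lambda>_. -1) M) (P(Suc m := v)) L"
    using generic_point.prems(3) v by (intro configuration_append_row) auto
  from generic_point.IH[OF _ _ this] show ?case
    using generic_point.prems by simp
next
  case (case_distinction Z m n M)
  \<comment> \<open>The configuration itself decides the unknown entries, so it satisfies exactly
    this case, which therefore cannot contradict the incidence axiom.\<close>
  define M' where
    "M' i j = (if (i, j) \<in> Z then if dot3 (L j) (P i) = 0 then 1 else -1 else M i j)" for i j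
  have filling: "filling Z M M'"
    by (simp add: filling_def M'_def)
  have config: "configuration m n M' P L"
    using case_distinction.prems(3) unfolding configuration_def M'_def by auto
  show ?case
  proof (cases "tautology M'")
    case True
    then show ?thesis
      using config case_distinction.prems(1,2) unfolding tautology_def configuration_def by auto
  next
    case False
    then show ?thesis
      using case_distinction.IH[OF filling _ configuration_incidence_axiom[OF config]]
        case_distinction.prems config by blast
  qed
next
  case (contradiction r m s n M)
  show ?case
  proof (rule ccontr)
    assume "dot3 (L 1) (P 1) \<noteq> 0"
    then have config: "configuration m n (assume_negation M) P L"
      using contradiction.prems(3) unfolding configuration_def assume_negation_def by auto
    from contradiction.IH[OF _ _ configuration_make_conclusion[OF this contradiction.hyps(1,2)]]
    have "dot3 (L s) (P r) = 0"
      using contradiction.prems by simp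
    with config contradiction.hyps(1-3) show False
      unfolding configuration_def by blast
  qed
qed

theorem theorem4p10:
  fixes F :: "'a::field itself" and m n :: nat and M :: "nat \<Rightarrow> nat \<Rightarrow> int"
  assumes "infinite (UNIV :: 'a set)"
    and "incidence_matrix m n M"
    and "sc_proof F m n M"
  shows "incidence_theorem_true F m n M"
proof -
  have "1 \<le> m" "1 \<le> n"
    using assms(2) by (simp_all add: incidence_matrix_def)
  then show ?thesis
    using sc_proof_sound[OF assms(1,3)] by (intro incidence_theorem_trueI)
qed

end
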